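(* Let $\tilde K=\min(n,K)$. There exists an offline algorithm (\textsc{Greedy+Max}) that gives a $\tfrac12$-approximation for the problem of maximizing a non-negative monotone submodular function subject to a knapsack constraint, using $O(\tilde K n)$ value-oracle queries to $f$ and $O(\tilde K n)$ running time.
   Context: Problem (submodular maximization under a knapsack constraint): a finite universe $U$ and a set $E=\{e_1,\dots,e_n\}\subseteq U$ of $n$ items are given, together with a cost function $c$ on items, a capacity $K>0$, and value-oracle access to a set function $f:2^U\to\mathbb R_{\ge 0}$ that is monotone ($f(S)\le f(T)$ for $S\subseteq T$) and submodular ($f(T\cup\{e\})-f(T)\le f(S\cup\{e\})-f(S)$ for all $S\subseteq T\subseteq U$, $e\in U$). For $S\subseteq E$ write $c(S)=\sum_{e\in S}c(e)$; $S$ is feasible if $c(S)\le K$. The goal is to find a feasible $S$ maximizing $f(S)$; let $\mathsf{OPT}$ be an optimal feasible set. Standing assumption: $1\le c(e)\le K$ for every item $e$, so that $\tilde K=\min(n,K)$ bounds the number of items in any feasible set. An algorithm gives an $\alpha$-approximation if it outputs a feasible $S$ with $f(S)\ge \alpha f(\mathsf{OPT})$. In the offline model the algorithm may access any item at any time; query complexity counts oracle evaluations of $f$. *)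

theory Defs
  imports Complex_Main
begin

section \<open>Submodular maximization under a knapsack constraint\<close>

definition submodular_on :: "'a set \<Rightarrow> ('a set \<Rightarrow> real) \<Rightarrow> bool" where
  "submodular_on U f \<longleftrightarrow>
     (\<forall>S T. \<forall>e\<in>U. S \<subseteq> T \<longrightarrow> T \<subseteq> U \<longrightarrow>
        f (T \<union> {e}) - f T \<le> f (S \<union> {e}) - f S)"

text \<open>The list \<open>es\<close> enumerates the items: \<open>E = set es\<close>, \<open>n = length es\<close>.\<close>

locale submodular_knapsack =
  fixes U :: "'a set" and es :: "'a list" and c :: "'a \<Rightarrow> real"
    and K :: real and f :: "'a set \<Rightarrow> real"
  assumes finite_universe: "finite U"
    and distinct_items: "distinct es"
    and items_subset: "set es \<subseteq> U"
    and capacity_pos: "K > 0"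
    and cost_bounds: "\<forall>e\<in>set es. 1 \<le> c e \<and> c e \<le> K"
    and nonneg: "\<forall>S\<subseteq>U. 0 \<le> f S"
    and monotone: "mono_on (Pow U) f"
    and submodular: "submodular_on U f"

definition feasible :: "'a list \<Rightarrow> ('a \<Rightarrow> real) \<Rightarrow> real \<Rightarrow> 'a set \<Rightarrow> bool" where
  "feasible es c K S \<longleftrightarrow> S \<subseteq> set es \<and> (\<Sum>e\<in>S. c e) \<le> K"

definition approximates ::
    "real \<Rightarrow> 'a list \<Rightarrow> ('a \<Rightarrow> real) \<Rightarrow> real \<Rightarrow> ('a set \<Rightarrow> real) \<Rightarrow> 'a set \<Rightarrow> bool" where
  "approximates \<alpha> es c K f S \<longleftrightarrow>
     feasible es c K S \<and>
     (\<forall>Opt. is_arg_max f (feasible es c K) Opt \<longrightarrow> f S \<ge> \<alpha> * f Opt)"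

definition K_tilde :: "nat \<Rightarrow> real \<Rightarrow> real" where
  "K_tilde n K = min (real n) K"


section \<open>Algorithms: a unit-cost real RAM with a value oracle\<close>

text \<open>
  Programs are finite and uniform in the input. A state consists of index registers, real
  registers (both also addressable indirectly) and bit vectors over item indices, represented
  as sets of naturals; bit vectors can be changed and tested only one bit at a time. Index
  arithmetic is restricted to addition and truncated subtraction, real constants to integers,
  and there is no conversion between reals and indices.
\<close>

record state =
  ireg :: "nat \<Rightarrow> nat"
  rreg :: "nat \<Rightarrow> real"
  bits :: "nat \<Rightarrow> nat set"

text \<open>The first argument of an instruction is its target, except that \<open>IStore a b\<close> and
  \<open>RStore a x\<close> write to the register whose address is in index register \<open>a\<close>.
  \<open>Cost x a\<close> reads the cost of the item whose index is in index register \<open>a\<close>;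
  \<open>Query x v\<close> evaluates the oracle on the items selected by bit vector \<open>v\<close>.\<close>

datatype instr =
    Nop
  | IConst nat nat | ICopy nat nat | IAdd nat nat nat | ISub nat nat nat
  | ILoad nat nat | IStore nat nat
  | RConst nat int | RCopy nat nat
  | RAdd nat nat nat | RSub nat nat nat | RMul nat nat nat | RDiv nat nat nat
  | RLoad nat nat | RStore nat nat
  | Insert nat nat | Remove nat nat
  | Cost nat nat
  | Query nat nat

datatype test = ILess nat nat | RLess nat nat | RLeq nat nat | Member nat nat

datatype prog =
    Do instr
  | Seq prog prog
  | Cond test prog prog
  | Loop test prog

abbreviation set_ireg :: "nat \<Rightarrow> nat \<Rightarrow> state \<Rightarrow> state" where
  "set_ireg a k s \<equiv> s\<lparr>ireg := (ireg s)(a := k)\<rparr>"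

abbreviation set_rreg :: "nat \<Rightarrow> real \<Rightarrow> state \<Rightarrow> state" where
  "set_rreg x r s \<equiv> s\<lparr>rreg := (rreg s)(x := r)\<rparr>"

abbreviation set_bits :: "nat \<Rightarrow> nat set \<Rightarrow> state \<Rightarrow> state" where
  "set_bits v I s \<equiv> s\<lparr>bits := (bits s)(v := I)\<rparr>"

text \<open>Here \<open>cost\<close> and \<open>F\<close> are the cost table and the value oracle, in terms of item indices.\<close>

fun step :: "(nat \<Rightarrow> real) \<Rightarrow> (nat set \<Rightarrow> real) \<Rightarrow> instr \<Rightarrow> state \<Rightarrow> state" where
  "step cost F Nop s = s"
| "step cost F (IConst a k) s = set_ireg a k s"
| "step cost F (ICopy a b) s = set_ireg a (ireg s b) s"
| "step cost F (IAdd a b d) s = set_ireg a (ireg s b + ireg s d) s"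
| "step cost F (ISub a b d) s = set_ireg a (ireg s b - ireg s d) s"
| "step cost F (ILoad a b) s = set_ireg a (ireg s (ireg s b)) s"
| "step cost F (IStore a b) s = set_ireg (ireg s a) (ireg s b) s"
| "step cost F (RConst x z) s = set_rreg x (of_int z) s"
| "step cost F (RCopy x y) s = set_rreg x (rreg s y) s"
| "step cost F (RAdd x y z) s = set_rreg x (rreg s y + rreg s z) s"
| "step cost F (RSub x y z) s = set_rreg x (rreg s y - rreg s z) s"
| "step cost F (RMul x y z) s = set_rreg x (rreg s y * rreg s z) s"
| "step cost F (RDiv x y z) s = set_rreg x (rreg s y / rreg s z) s"
| "step cost F (RLoad x a) s = set_rreg x (rreg s (ireg s a)) s"
| "step cost F (RStore a x) s = set_rreg (ireg s a) (rreg s x) s"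
| "step cost F (Insert v a) s = set_bits v (insert (ireg s a) (bits s v)) s"
| "step cost F (Remove v a) s = set_bits v (bits s v - {ireg s a}) s"
| "step cost F (Cost x a) s = set_rreg x (cost (ireg s a)) s"
| "step cost F (Query x v) s = set_rreg x (F (bits s v)) s"

fun queries :: "instr \<Rightarrow> nat" where
  "queries (Query x v) = 1"
| "queries _ = 0"

fun holds :: "test \<Rightarrow> state \<Rightarrow> bool" where
  "holds (ILess a b) s \<longleftrightarrow> ireg s a < ireg s b"
| "holds (RLess x y) s \<longleftrightarrow> rreg s x < rreg s y"
| "holds (RLeq x y) s \<longleftrightarrow> rreg s x \<le> rreg s y"
| "holds (Member v a) s \<longleftrightarrow> ireg s a \<in> bits s v"

text \<open>\<open>exec cost F P s q t s'\<close>: started in \<open>s\<close>, program \<open>P\<close> halts in \<open>s'\<close> after \<open>q\<close> oracle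
  queries and \<open>t\<close> time steps. Every instruction (oracle queries included) and every evaluation
  of a test takes one time step.\<close>

inductive exec :: "(nat \<Rightarrow> real) \<Rightarrow> (nat set \<Rightarrow> real) \<Rightarrow>
    prog \<Rightarrow> state \<Rightarrow> nat \<Rightarrow> nat \<Rightarrow> state \<Rightarrow> bool"
  for cost :: "nat \<Rightarrow> real" and F :: "nat set \<Rightarrow> real" where
  exec_Do: "exec cost F (Do i) s (queries i) 1 (step cost F i s)"
| exec_Seq: "exec cost F P s q t s' \<Longrightarrow> exec cost F Q s' q' t' s'' \<Longrightarrow>
    exec cost F (Seq P Q) s (q + q') (t + t') s''"
| exec_Cond_True: "holds b s \<Longrightarrow> exec cost F P s q t s' \<Longrightarrow>
    exec cost F (Cond b P Q) s q (t + 1) s'"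
| exec_Cond_False: "\<not> holds b s \<Longrightarrow> exec cost F Q s q t s' \<Longrightarrow>
    exec cost F (Cond b P Q) s q (t + 1) s'"
| exec_Loop_False: "\<not> holds b s \<Longrightarrow> exec cost F (Loop b P) s 0 1 s"
| exec_Loop_True: "holds b s \<Longrightarrow> exec cost F P s q t s' \<Longrightarrow>
    exec cost F (Loop b P) s' q' t' s'' \<Longrightarrow>
    exec cost F (Loop b P) s (q + q') (t + t' + 1) s''"

inductive_cases exec_DoE: "exec cost F (Do i) s q t s'"
inductive_cases exec_SeqE: "exec cost F (Seq P Q) s q t s'"
inductive_cases exec_CondE: "exec cost F (Cond b P Q) s q t s'"
inductive_cases exec_LoopE: "exec cost F (Loop b P) s q t s'"

lemma exec_deterministic:
  assumes "exec cost F P s q t s'" and "exec cost F P s q' t' s''"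
  shows "q' = q \<and> t' = t \<and> s'' = s'"
  using assms
proof (induction arbitrary: q' t' s'' rule: exec.induct)
  case (exec_Do i s)
  then show ?case by (auto elim: exec_DoE)
next
  case (exec_Seq P s q t s' Q q1 t1 s1)
  from exec_Seq.prems obtain qa ta sa qb tb where
    "exec cost F P s qa ta sa" "exec cost F Q sa qb tb s''" "q' = qa + qb" "t' = ta + tb"
    by (auto elim: exec_SeqE)
  with exec_Seq.IH(1)[of qa ta sa] exec_Seq.IH(2)[of qb tb s''] show ?case by simp
next
  case (exec_Cond_True b s P q t s' Q)
  from exec_Cond_True.prems exec_Cond_True.hyps(1) obtain ta where
    "exec cost F P s q' ta s''" "t' = ta + 1"
    by (auto elim: exec_CondE)
  with exec_Cond_True.IH[of q' ta s''] show ?case by simp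
next
  case (exec_Cond_False b s Q q t s' P)
  from exec_Cond_False.prems exec_Cond_False.hyps(1) obtain ta where
    "exec cost F Q s q' ta s''" "t' = ta + 1"
    by (auto elim: exec_CondE)
  with exec_Cond_False.IH[of q' ta s''] show ?case by simp
next
  case (exec_Loop_False b s P)
  from exec_Loop_False.prems show ?case
    by (rule exec_LoopE) (simp_all add: exec_Loop_False.hyps)
next
  case (exec_Loop_True b s P q t s' q1 t1 s1)
  from exec_Loop_True.prems exec_Loop_True.hyps(1) obtain qa ta sa qb tb where
    "exec cost F P s qa ta sa" "exec cost F (Loop b P) sa qb tb s''"
    "q' = qa + qb" "t' = ta + tb + 1"
    by (auto elim: exec_LoopE)
  with exec_Loop_True.IH(1)[of qa ta sa] exec_Loop_True.IH(2)[of qb tb s''] show ?case by simp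
qed

definition select :: "'a list \<Rightarrow> nat set \<Rightarrow> 'a set" where
  "select es I = {es ! i | i. i \<in> I \<and> i < length es}"

definition initial_state :: "nat \<Rightarrow> real \<Rightarrow> state" where
  "initial_state n K = \<lparr>ireg = (\<lambda>_. 0)(0 := n), rreg = (\<lambda>_. 0)(0 := K), bits = (\<lambda>_. {})\<rparr>"

text \<open>\<open>computes P es c K f S q t\<close>: on the given instance \<open>P\<close> halts with output \<open>S\<close>, read off
  from bit vector 0, after \<open>q\<close> queries to \<open>f\<close> and \<open>t\<close> time steps. The program has access to
  \<open>f\<close> and \<open>c\<close> only through the instructions \<open>Query\<close> and \<open>Cost\<close>; any item may be accessed at
  any time.\<close>

definition computes :: "prog \<Rightarrow> 'a list \<Rightarrow> ('a \<Rightarrow> real) \<Rightarrow> real \<Rightarrow> ('a set \<Rightarrow> real) \<Rightarrow>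
    'a set \<Rightarrow> nat \<Rightarrow> nat \<Rightarrow> bool" where
  "computes P es c K f S q t \<longleftrightarrow>
     (\<exists>s. exec (\<lambda>i. if i < length es then c (es ! i) else 0) (\<lambda>I. f (select es I))
            P (initial_state (length es) K) q t s \<and>
          S = select es (bits s 0))"

end

theory Submission
  imports Defs
begin

text \<open>Greedy+Max repeatedly adds to a greedy set \<open>G\<close> the fitting item of best density and
  remembers the best set of the form \<open>G \<union> {x}\<close> seen on the way. Let \<open>e\<close> be the costliest item of
  an optimal set \<open>Opt\<close>. As long as \<open>c G \<le> K - c e\<close>, either \<open>f (G \<union> {e}) \<ge> f Opt / 2\<close>, or the best
  density is at least \<open>f Opt / (2 * (K - c e))\<close>. In the latter case the bound
  \<open>f G \<ge> f Opt / 2 * c G / (K - c e)\<close> is preserved, and it gives \<open>f G \<ge> f Opt / 2\<close> once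
  \<open>c G\<close> exceeds \<open>K - c e\<close>. All costs being at least 1, there are at most \<open>min n K + 1\<close>
  rounds, each of which is linear in \<open>n\<close>.\<close>

section \<open>Bounded runs\<close>

text \<open>A total-correctness triple with a time budget. As \<open>exec\<close> is deterministic,
  the existential speaks about the only halting run. Queries are covered by the budget through
  \<open>exec_queries_le_time\<close>.\<close>

definition runs :: "(nat \<Rightarrow> real) \<Rightarrow> (nat set \<Rightarrow> real) \<Rightarrow> prog \<Rightarrow> state \<Rightarrow> nat \<Rightarrow> (state \<Rightarrow> bool) \<Rightarrow> bool"
  where "runs cost F P s T \<Phi> \<longleftrightarrow> (\<exists>q t s'. exec cost F P s q t s' \<and> t \<le> T \<and> \<Phi> s')"

lemma exec_queries_le_time: "exec cost F P s q t s' \<Longrightarrow> q \<le> t"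
proof (induction rule: exec.induct)
  case (exec_Do i s)
  show ?case by (cases i) simp_all
qed simp_all

lemma runs_mono:
  assumes "runs cost F P s T \<Phi>" "T \<le> T'" "\<And>s'. \<Phi> s' \<Longrightarrow> \<Psi> s'"
  shows "runs cost F P s T' \<Psi>"
  using assms unfolding runs_def by (meson order_trans)

lemma runs_Seq:
  assumes "runs cost F P s T \<Phi>" "\<And>s'. \<Phi> s' \<Longrightarrow> runs cost F Q s' T' \<Psi>"
  shows "runs cost F (Seq P Q) s (T + T') \<Psi>"
  using assms unfolding runs_def by (meson exec_Seq add_mono)

lemma runs_Cond:
  assumes "holds b s \<Longrightarrow> runs cost F P s T \<Phi>" "\<not> holds b s \<Longrightarrow> runs cost F Q s T \<Phi>"
  shows "runs cost F (Cond b P Q) s (T + 1) \<Phi>"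
  using assms unfolding runs_def
  by (cases "holds b s") (meson exec_Cond_True exec_Cond_False add_le_mono1)+

text \<open>Each iteration lowers the measure and costs \<open>T\<close> plus one step for its test;
  the extra step is the final failing test.\<close>

lemma runs_Loop:
  fixes m :: "state \<Rightarrow> nat"
  assumes init: "I s"
    and body: "\<And>s. I s \<Longrightarrow> holds b s \<Longrightarrow> runs cost F P s T (\<lambda>s'. I s' \<and> m s' < m s)"
  shows "runs cost F (Loop b P) s (m s * (T + 1) + 1) (\<lambda>s'. I s' \<and> \<not> holds b s')"
  using init
proof (induction "m s" arbitrary: s rule: less_induct)
  case less
  show ?case
  proof (cases "holds b s")
    case False
    then show ?thesis
      using less.prems exec_Loop_False[OF False, of cost F P] unfolding runs_def by fastforce
  next
    case True
    obtain q t s' where 1: "exec cost F P s q t s'" "t \<le> T" "I s'" "m s' < m s"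
      using body[OF less.prems True] unfolding runs_def by blast
    obtain q' t' s'' where 2: "exec cost F (Loop b P) s' q' t' s''"
      "t' \<le> m s' * (T + 1) + 1" "I s''" "\<not> holds b s''"
      using less.hyps[OF 1(4,3)] unfolding runs_def by blast
    have "t + t' + 1 \<le> Suc (m s') * (T + 1) + 1" using 1(2) 2(2) by simp
    also have "\<dots> \<le> m s * (T + 1) + 1" using 1(4) by (intro add_right_mono mult_right_mono) auto
    finally show ?thesis
      using exec_Loop_True[OF True 1(1) 2(1)] 2(3,4) unfolding runs_def by blast
  qed
qed

section \<open>Straight-line code\<close>

fun loop_free :: "prog \<Rightarrow> bool" where
  "loop_free (Do i) = True"
| "loop_free (Seq P Q) = (loop_free P \<and> loop_free Q)"
| "loop_free (Cond b P Q) = (loop_free P \<and> loop_free Q)"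
| "loop_free (Loop b P) = False"

text \<open>The values of the next two functions on loops are junk.\<close>

fun denote :: "(nat \<Rightarrow> real) \<Rightarrow> (nat set \<Rightarrow> real) \<Rightarrow> prog \<Rightarrow> state \<Rightarrow> state" where
  "denote cost F (Do i) s = step cost F i s"
| "denote cost F (Seq P Q) s = denote cost F Q (denote cost F P s)"
| "denote cost F (Cond b P Q) s = (if holds b s then denote cost F P s else denote cost F Q s)"
| "denote cost F (Loop b P) s = s"

fun duration :: "prog \<Rightarrow> nat" where
  "duration (Do i) = 1"
| "duration (Seq P Q) = duration P + duration Q"
| "duration (Cond b P Q) = max (duration P) (duration Q) + 1"
| "duration (Loop b P) = 0"

text \<open>Lets the simplifier execute straight-line code symbolically. A conditional is charged
  for its longer branch.\<close>

lemma runs_loop_free: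
  assumes "loop_free P"
  shows "runs cost F P s (duration P) (\<lambda>s'. s' = denote cost F P s)"
  using assms
proof (induction P arbitrary: s)
  case (Do i)
  show ?case using exec_Do[of cost F i s] by (auto simp: runs_def)
next
  case (Seq P Q)
  then show ?case by (auto intro!: runs_Seq)
next
  case (Cond b P Q)
  then have "runs cost F P s (duration P) (\<lambda>s'. s' = denote cost F P s)"
    "runs cost F Q s (duration Q) (\<lambda>s'. s' = denote cost F Q s)"
    by simp_all
  then show ?case
    unfolding duration.simps denote.simps
    by (intro runs_Cond) (auto intro: runs_mono)
qed simp

section \<open>The greedy step\<close>

context submodular_knapsack
begin

abbreviation weight :: "'a set \<Rightarrow> real" where
  "weight S \<equiv> sum c S"

definition candidates :: "'a set \<Rightarrow> 'a set" where
  "candidates G = {e \<in> set es - G. c e \<le> K - weight G}"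

definition density :: "'a set \<Rightarrow> 'a \<Rightarrow> real" where
  "density G e = (f (insert e G) - f G) / c e"

text \<open>The inequality is multiplied out so that it stays meaningful when
  \<open>c e = K\<close>; \<open>v\<close> stands for the best value seen so far.\<close>

definition half_progress :: "'a set \<Rightarrow> real \<Rightarrow> 'a set \<Rightarrow> 'a \<Rightarrow> bool" where
  "half_progress G v Opt e \<longleftrightarrow>
     f Opt / 2 \<le> v \<or> weight G \<le> K - c e \<and> f Opt / 2 * weight G \<le> (K - c e) * f G"

lemma f_mono: "A \<subseteq> B \<Longrightarrow> B \<subseteq> U \<Longrightarrow> f A \<le> f B"
  using monotone by (auto simp: mono_on_def)

lemma f_submodular:
  "A \<subseteq> B \<Longrightarrow> B \<subseteq> U \<Longrightarrow> e \<in> U \<Longrightarrow> f (insert e B) - f B \<le> f (insert e A) - f A"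
  using submodular unfolding submodular_on_def by (metis Un_insert_right sup_bot.right_neutral)

lemma cost_pos: "e \<in> set es \<Longrightarrow> 0 < c e"
  using cost_bounds by force

lemma weight_nonneg: "S \<subseteq> set es \<Longrightarrow> 0 \<le> weight S"
  using cost_pos by (meson less_imp_le subset_iff sum_nonneg)

text \<open>Every cost is at least 1, which turns the capacity into a bound on the number of
  rounds.\<close>

lemma card_le_weight:
  assumes "S \<subseteq> set es"
  shows "real (card S) \<le> weight S"
  using sum_mono[of S "\<lambda>_. 1" c] assms cost_bounds by auto

text \<open>Add \<open>B\<close> to \<open>A\<close> item by item: by submodularity each gain is at
  most the marginal over the smaller set \<open>G\<close>.\<close>

lemma union_le_sum_marginals:
  assumes "finite B" "A \<subseteq> U" "B \<subseteq> U" "G \<subseteq> A"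
  shows "f (A \<union> B) \<le> f A + (\<Sum>e\<in>B. f (insert e G) - f G)"
  using assms
proof (induction B rule: finite_induct)
  case (insert x B)
  have "f (insert x (A \<union> B)) - f (A \<union> B) \<le> f (insert x G) - f G"
    using insert.prems by (intro f_submodular) auto
  with insert show ?case by simp
qed simp

lemma density_nonneg:
  assumes "G \<subseteq> set es" "e \<in> set es"
  shows "0 \<le> density G e"
proof -
  have "f G \<le> f (insert e G)" using assms items_subset by (intro f_mono) auto
  then show ?thesis using cost_pos[OF assms(2)] by (simp add: density_def)
qed

lemma half_progress_empty:
  assumes "feasible es c K Opt" "e \<in> Opt"
  shows "half_progress {} v Opt e"
proof -
  have "c e \<le> K" "f {} \<ge> 0" using assms cost_bounds nonneg by (auto simp: feasible_def)
  then show ?thesis by (simp add: half_progress_def)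
qed

text \<open>While \<open>G\<close> leaves room for the costliest item \<open>e\<close> of \<open>Opt\<close>, every missing item of \<open>Opt\<close> is
  a candidate. So if \<open>f (insert e G)\<close> is below half the optimum, the other items of \<open>Opt\<close>,
  of total cost at most \<open>K - c e\<close>, must contribute the other half, and the best
  density exceeds \<open>f Opt / (2 * (K - c e))\<close>.\<close>

lemma half_progress_insert:
  assumes opt: "feasible es c K Opt" "e \<in> Opt" "\<And>x. x \<in> Opt \<Longrightarrow> c x \<le> c e"
    and G: "G \<subseteq> set es"
    and progress: "half_progress G v Opt e"
    and v': "v \<le> v'" "f G \<le> v'" "\<And>x. x \<in> candidates G \<Longrightarrow> f (insert x G) \<le> v'"
    and g: "g \<in> candidates G" "\<And>x. x \<in> candidates G \<Longrightarrow> density G x \<le> density G g"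
  shows "half_progress (insert g G) v' Opt e"
proof (cases "f Opt / 2 \<le> v'")
  case True
  then show ?thesis by (simp add: half_progress_def)
next
  case False
  with progress v'(1) have w: "weight G \<le> K - c e"
    and inv: "f Opt / 2 * weight G \<le> (K - c e) * f G"
    by (auto simp: half_progress_def)
  have OptE: "Opt \<subseteq> set es" "weight Opt \<le> K" using opt by (auto simp: feasible_def)
  have fin: "finite Opt" "finite G" using OptE G finite_subset by auto
  have gE: "g \<in> set es" "g \<notin> G" using g by (auto simp: candidates_def)
  have cand: "x \<in> candidates G" if "x \<in> Opt" "x \<notin> G" for x
    using that OptE opt(3)[of x] w by (auto simp: candidates_def)
  \<comment> \<open>If \<open>e\<close> is already in \<open>G\<close>, the value is
    \<open>f G\<close>, at most \<open>v'\<close>; otherwise \<open>e\<close> is itself a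
    candidate.\<close>
  have low: "f (insert e G) < f Opt / 2"
  proof (cases "e \<in> G")
    case True
    then show ?thesis using False v'(2) by (simp add: insert_absorb)
  next
    case False
    then show ?thesis using cand[OF opt(2)] v'(3)[of e] \<open>\<not> f Opt / 2 \<le> v'\<close> by simp
  qed
  define R where "R = Opt - G - {e}"
  have R: "R \<subseteq> Opt" "e \<notin> R" "finite R" using fin by (auto simp: R_def)
  have nd: "0 \<le> density G g"
    using density_nonneg[OF G gE(1)] .
  have "f Opt \<le> f (insert e G \<union> R)"
    using OptE G opt(2) items_subset by (intro f_mono) (auto simp: R_def)
  also have "\<dots> \<le> f (insert e G) + (\<Sum>x\<in>R. f (insert x G) - f G)"
    using R OptE G opt(2) items_subset by (intro union_le_sum_marginals) auto
  also have "(\<Sum>x\<in>R. f (insert x G) - f G) \<le> (\<Sum>x\<in>R. density G g * c x)"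
  proof (rule sum_mono)
    fix x assume x: "x \<in> R"
    then have "density G x \<le> density G g" "0 < c x"
      using cand g(2) cost_pos OptE by (auto simp: R_def)
    then show "f (insert x G) - f G \<le> density G g * c x"
      by (simp add: density_def pos_divide_le_eq)
  qed
  also have "\<dots> = density G g * weight R" by (simp add: sum_distrib_left)
  also have "\<dots> \<le> density G g * (K - c e)"
  proof (rule mult_left_mono[OF _ nd])
    have "weight (insert e R) \<le> weight Opt"
      using R fin opt(2) OptE cost_pos by (intro sum_mono2) (auto intro: less_imp_le)
    then show "weight R \<le> K - c e" using R OptE by simp
  qed
  finally have dens: "f Opt / 2 \<le> density G g * (K - c e)" using low by simp
  \<comment> \<open>Scaled by \<open>c g\<close>, the density bound says that the gain from
    \<open>g\<close> pays for the growth of the left side of the invariant.\<close>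
  have "f Opt / 2 * c g \<le> density G g * (K - c e) * c g"
    using dens cost_pos[OF gE(1)] by (intro mult_right_mono) auto
  also have "\<dots> = (K - c e) * (f (insert g G) - f G)"
    using cost_pos[OF gE(1)] by (simp add: density_def)
  finally have *: "f Opt / 2 * weight (insert g G) \<le> (K - c e) * f (insert g G)"
    using inv gE fin by (simp add: algebra_simps add_divide_distrib)
  have "weight (insert g G) \<le> K - c e"
  proof (rule ccontr)
    assume gt: "\<not> weight (insert g G) \<le> K - c e"
    have pos: "0 \<le> f Opt / 2" using nonneg OptE items_subset by auto
    have Ke: "0 \<le> K - c e" using weight_nonneg[OF G] w by linarith
    have "f Opt / 2 * (K - c e) \<le> f Opt / 2 * weight (insert g G)"
      using gt pos by (intro mult_left_mono) auto
    also note *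
    also have "(K - c e) * f (insert g G) \<le> (K - c e) * v'"
      using v'(3)[OF g(1)] Ke by (intro mult_left_mono)
    finally have "(K - c e) * (f Opt / 2 - v') \<le> 0" by (simp add: algebra_simps)
    moreover have "0 < f Opt / 2 - v'" using False by simp
    \<comment> \<open>Overshooting \<open>K - c e\<close> would already give half the optimum if
      \<open>K - c e\<close> were positive. In the degenerate case \<open>K = c e\<close>,
      \<open>dens\<close> forces \<open>f Opt / 2 \<le> 0\<close>, which \<open>v'\<close> trivially
      reaches.\<close>
    ultimately have "K - c e = 0" using Ke by (smt (verit) mult_pos_pos)
    with dens have "f Opt / 2 \<le> 0" by simp
    moreover have "0 \<le> f G" using nonneg G items_subset by auto
    ultimately show False using v'(2) False by linarith
  qed
  with * show ?thesis by (simp add: half_progress_def)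
qed

text \<open>If \<open>v\<close> were below half the optimum, \<open>G\<close> would leave room for
  \<open>e\<close> and so for each single item of \<open>Opt\<close>. Without candidates,
  \<open>G\<close> must then contain \<open>Opt\<close>.\<close>

lemma half_progress_final:
  assumes opt: "feasible es c K Opt" "\<And>x. x \<in> Opt \<Longrightarrow> c x \<le> c e"
    and G: "G \<subseteq> set es" and "f G \<le> v" "candidates G = {}" "half_progress G v Opt e"
  shows "f Opt / 2 \<le> v"
proof (rule ccontr)
  assume neg: "\<not> f Opt / 2 \<le> v"
  then have w: "weight G \<le> K - c e" using assms by (auto simp: half_progress_def)
  have OptE: "Opt \<subseteq> set es" using opt by (auto simp: feasible_def)
  have "Opt \<subseteq> G"
  proof
    fix x assume "x \<in> Opt"
    then show "x \<in> G" using opt(2)[of x] w OptE assms(5) by (force simp: candidates_def)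
  qed
  then have "f Opt \<le> f G" using G items_subset by (intro f_mono) auto
  moreover have "0 \<le> f Opt" using nonneg OptE items_subset by auto
  ultimately show False using neg assms(4) by linarith
qed

end

section \<open>The program\<close>

notation Seq (infixr ";;" 55)

text \<open>Index registers: 0 holds \<open>n\<close>, 1 the loop counter, 4 the constant 1; 2 and 3 hold the
  candidates of best density and of best value found in the current scan, \<open>n\<close> meaning none.
  Real registers: 0 holds the remaining capacity, 1 the value of the greedy set, 2 the best
  density of the current scan (-1 before the first candidate), 3 the best value so far; 4 to 6
  are scratch. Bit vector 0 holds the best solution so far and 1 the greedy set.\<close>

definition scan_body :: prog where
  "scan_body =
     Cond (Member 1 1) (Do Nop)
       (Do (Cost 4 1);;
        Cond (RLeq 4 0)
          (Do (Insert 1 1);; Do (Query 5 1);; Do (Remove 1 1);;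
           Cond (RLess 3 5) (Do (RCopy 3 5);; Do (ICopy 3 1)) (Do Nop);;
           Do (RSub 6 5 1);; Do (RDiv 6 6 4);;
           Cond (RLess 2 6) (Do (RCopy 2 6);; Do (ICopy 2 1)) (Do Nop))
          (Do Nop));;
     Do (IAdd 1 1 4)"

text \<open>Bit vectors change one bit at a time, so copying one takes a loop over all
  indices.\<close>

definition copy_body :: prog where
  "copy_body = Cond (Member 1 1) (Do (Insert 0 1)) (Do (Remove 0 1));; Do (IAdd 1 1 4)"

definition start_scan :: prog where
  "start_scan = Do (IConst 1 0);; Do (ICopy 2 0);; Do (ICopy 3 0);; Do (RConst 2 (-1))"

text \<open>The scan only remembers an index; the set is copied once per round, as a copy at every
  improvement could make the round quadratic.\<close>

definition save :: prog where
  "save = Cond (ILess 3 0)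
     ((Do (Insert 1 3);; Do (IConst 1 0));; Loop (ILess 1 0) copy_body;; Do (Remove 1 3)) (Do Nop)"

text \<open>The scan keeps the density of the chosen item but not its value, so the oracle is asked
  again.\<close>

definition extend :: prog where
  "extend = Do (Insert 1 2);; Do (Cost 4 2);; Do (RSub 0 0 4);; Do (Query 1 1)"

definition greedy_round :: prog where
  "greedy_round =
     start_scan;; Loop (ILess 1 0) scan_body;; Cond (ILess 2 0) (save;; extend) (Do Nop)"

text \<open>Index register 2 starts at 0, so the first round is entered whenever there are items;
  the loop ends after a scan without candidates.\<close>

definition greedy_max :: prog where
  "greedy_max = (Do (Query 3 1);; Do (RCopy 1 3);; Do (IConst 4 1));; Loop (ILess 2 0) greedy_round"

text \<open>The instance as the machine sees it: items are their own indices, so bit vectors are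
  sets of items.\<close>

locale indexed_knapsack =
  submodular_knapsack "{..<n}" "[0..<n]" cost K F
  for n :: nat and cost :: "nat \<Rightarrow> real" and K :: real and F :: "nat set \<Rightarrow> real"
begin

section \<open>One scan over the candidates\<close>

definition best_density :: "nat set \<Rightarrow> nat set \<Rightarrow> nat \<Rightarrow> real \<Rightarrow> bool" where
  "best_density G D g r \<longleftrightarrow>
     g = n \<and> D = {} \<and> r = -1 \<or> g \<in> D \<and> r = density G g \<and> (\<forall>x\<in>D. density G x \<le> r)"

definition best_value :: "nat set \<Rightarrow> nat set \<Rightarrow> real \<Rightarrow> nat \<Rightarrow> real \<Rightarrow> bool" where
  "best_value G D v0 h v \<longleftrightarrow>
     v0 \<le> v \<and> (\<forall>x\<in>D. F (insert x G) \<le> v) \<and> (h = n \<and> v = v0 \<or> h \<in> D \<and> v = F (insert h G))"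

text \<open>Densities are nonnegative, so the first candidate always beats the initial -1.\<close>

lemma best_density_insert:
  assumes "best_density G D g r" "0 \<le> density G j"
  shows "r < density G j \<Longrightarrow> best_density G (insert j D) j (density G j)"
    and "\<not> r < density G j \<Longrightarrow> best_density G (insert j D) g r"
  using assms unfolding best_density_def by auto

lemma best_value_insert:
  assumes "best_value G D v0 h v"
  shows "v < F (insert j G) \<Longrightarrow> best_value G (insert j D) v0 j (F (insert j G))"
    and "\<not> v < F (insert j G) \<Longrightarrow> best_value G (insert j D) v0 h v"
  using assms unfolding best_value_def by auto

definition scan_inv :: "nat set \<Rightarrow> nat set \<Rightarrow> real \<Rightarrow> state \<Rightarrow> bool" where
  "scan_inv G S v0 s \<longleftrightarrow>
     ireg s 0 = n \<and> ireg s 4 = 1 \<and> ireg s 1 \<le> n \<and> bits s 1 = G \<and> bits s 0 = S \<and>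
     rreg s 0 = K - weight G \<and> rreg s 1 = F G \<and>
     best_density G (candidates G \<inter> {..<ireg s 1}) (ireg s 2) (rreg s 2) \<and>
     best_value G (candidates G \<inter> {..<ireg s 1}) v0 (ireg s 3) (rreg s 3)"

lemma scan_body_step:
  assumes inv: "scan_inv G S v0 s" and G: "G \<subseteq> {..<n}" and less: "ireg s 1 < n"
  shows "scan_inv G S v0 (denote cost F scan_body s) \<and>
    ireg (denote cost F scan_body s) 1 = Suc (ireg s 1)"
proof (cases "ireg s 1 \<in> candidates G")
  case False
  then have "candidates G \<inter> {..<Suc (ireg s 1)} = candidates G \<inter> {..<ireg s 1}"
    by (auto simp: less_Suc_eq)
  moreover have "ireg s 1 \<in> G \<or> \<not> cost (ireg s 1) \<le> K - weight G"
    using False less by (auto simp: candidates_def)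
  ultimately show ?thesis
    using inv less by (auto simp: scan_inv_def scan_body_def)
next
  case True
  define j where "j = ireg s 1"
  have D: "candidates G \<inter> {..<j + 1} = insert j (candidates G \<inter> {..<j})"
    using True by (auto simp: j_def less_Suc_eq)
  have j: "j \<notin> G" "cost j \<le> K - weight G" "j < n"
    using True less by (auto simp: candidates_def j_def)
  have dens: "(F (insert j G) - F G) / cost j = density G j" by (simp add: density_def)
  have nd: "0 \<le> density G j" using density_nonneg[of G j] G j by (auto simp: atLeast0LessThan)
  \<comment> \<open>The query is made with \<open>j\<close> temporarily inserted; since
    \<open>j\<close> was absent, removing it restores \<open>G\<close>.\<close>
  have rem: "insert j G - {j} = G" using j by auto
  note inv' = inv[unfolded scan_inv_def, folded j_def]
  have "best_density G (candidates G \<inter> {..<j}) (ireg s 2) (rreg s 2)"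
    and "best_value G (candidates G \<inter> {..<j}) v0 (ireg s 3) (rreg s 3)"
    using inv' by blast+
  note d = best_density_insert[OF this(1) nd] and v = best_value_insert[OF this(2), of j]
  show ?thesis
    using inv' j rem D
    by (simp add: scan_inv_def scan_body_def j_def[symmetric] dens d v del: One_nat_def)
qed

lemma runs_scan:
  assumes "scan_inv G S v0 s" "G \<subseteq> {..<n}" "ireg s 1 = 0"
  shows "runs cost F (Loop (ILess 1 0) scan_body) s (16 * n + 1)
    (\<lambda>s'. scan_inv G S v0 s' \<and> ireg s' 1 = n)"
proof -
  \<comment> \<open>The longest path through the body takes 15 steps; the loop test makes it 16 per
    index.\<close>
  have dur: "duration scan_body = 15" "loop_free scan_body" by (simp_all add: scan_body_def)
  have "runs cost F (Loop (ILess 1 0) scan_body) s ((n - ireg s 1) * (15 + 1) + 1)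
    (\<lambda>s'. scan_inv G S v0 s' \<and> \<not> holds (ILess 1 0) s')"
  proof (rule runs_Loop[where m = "\<lambda>s. n - ireg s 1"])
    fix s assume inv: "scan_inv G S v0 s" and "holds (ILess 1 0) s"
    then have less: "ireg s 1 < n" by (simp add: scan_inv_def)
    show "runs cost F scan_body s 15 (\<lambda>s'. scan_inv G S v0 s' \<and> n - ireg s' 1 < n - ireg s 1)"
      by (rule runs_mono[OF runs_loop_free[OF dur(2)]])
        (use scan_body_step[OF inv assms(2) less] less dur in auto)
  qed (use assms in auto)
  then show ?thesis
    by (rule runs_mono) (use assms in \<open>auto simp: scan_inv_def\<close>)
qed

section \<open>Saving the best solution\<close>

definition copied_upto :: "state \<Rightarrow> nat \<Rightarrow> state \<Rightarrow> bool" where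
  "copied_upto s i s' \<longleftrightarrow>
     (\<forall>a. a \<noteq> 1 \<longrightarrow> ireg s' a = ireg s a) \<and> rreg s' = rreg s \<and> bits s' 1 = bits s 1 \<and>
     bits s' 0 \<subseteq> {..<n} \<and> bits s' 0 \<inter> {..<i} = bits s 1 \<inter> {..<i}"

lemma runs_copy:
  assumes s: "ireg s 0 = n" "ireg s 4 = 1" "ireg s 1 = 0" "bits s 0 \<subseteq> {..<n}" "bits s 1 \<subseteq> {..<n}"
  shows "runs cost F (Loop (ILess 1 0) copy_body) s (4 * n + 1)
    (\<lambda>s'. (\<forall>a. a \<noteq> 1 \<longrightarrow> ireg s' a = ireg s a) \<and> rreg s' = rreg s \<and>
      bits s' 1 = bits s 1 \<and> bits s' 0 = bits s 1)"
proof -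
  have dur: "duration copy_body = 3" "loop_free copy_body" by (simp_all add: copy_body_def)
  let ?I = "\<lambda>s'. copied_upto s (ireg s' 1) s' \<and> ireg s' 1 \<le> n"
  have "runs cost F (Loop (ILess 1 0) copy_body) s ((n - ireg s 1) * (3 + 1) + 1)
    (\<lambda>s'. ?I s' \<and> \<not> holds (ILess 1 0) s')"
  proof (rule runs_Loop[where m = "\<lambda>s. n - ireg s 1"])
    show "?I s" using s by (simp add: copied_upto_def)
    fix s' assume I: "?I s'" and "holds (ILess 1 0) s'"
    then have less: "ireg s' 1 < n" using s by (simp add: copied_upto_def)
    have "?I (denote cost F copy_body s') \<and> ireg (denote cost F copy_body s') 1 = Suc (ireg s' 1)"
      using I less s by (auto simp: copied_upto_def copy_body_def lessThan_Suc)
    then show "runs cost F copy_body s' 3 (\<lambda>s''. ?I s'' \<and> n - ireg s'' 1 < n - ireg s' 1)"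
      by (intro runs_mono[OF runs_loop_free[OF dur(2)]]) (use less dur in auto)
  qed
  then show ?thesis
  proof (rule runs_mono)
    fix s' assume "?I s' \<and> \<not> holds (ILess 1 0) s'"
    then have c: "copied_upto s n s'" using s by (auto simp: copied_upto_def)
    \<comment> \<open>Both vectors lie below \<open>n\<close>, so agreement below \<open>n\<close>
      is equality; no stale bits survive.\<close>
    then have "bits s' 0 = bits s 1" using s by (auto simp: copied_upto_def)
    with c show "(\<forall>a. a \<noteq> 1 \<longrightarrow> ireg s' a = ireg s a) \<and> rreg s' = rreg s \<and>
      bits s' 1 = bits s 1 \<and> bits s' 0 = bits s 1"
      by (simp add: copied_upto_def)
  qed (use s in simp)
qed

lemma runs_save:
  assumes s: "ireg s 0 = n" "ireg s 4 = 1" "bits s 0 \<subseteq> {..<n}" "bits s 1 \<subseteq> {..<n}"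
    and new: "ireg s 3 \<notin> bits s 1"
  shows "runs cost F save s (4 * n + 5)
    (\<lambda>s'. (\<forall>a. a \<noteq> 1 \<longrightarrow> ireg s' a = ireg s a) \<and> rreg s' = rreg s \<and> bits s' 1 = bits s 1 \<and>
      bits s' 0 = (if ireg s 3 < n then insert (ireg s 3) (bits s 1) else bits s 0))"
    (is "runs _ _ _ _ _ ?Q")
proof -
  \<comment> \<open>Two set-up steps, the copy, one removal, and the outer test.\<close>
  have "runs cost F save s (2 + (4 * n + 1 + 1) + 1) ?Q"
    unfolding save_def
  proof (rule runs_Cond)
    assume "holds (ILess 3 0) s"
    then have h: "ireg s 3 < n" using s by simp
    show "runs cost F ((Do (Insert 1 3);; Do (IConst 1 0));; Loop (ILess 1 0) copy_body;; Do (Remove 1 3))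
      s (2 + (4 * n + 1 + 1)) ?Q"
    proof (rule runs_Seq)
      show "runs cost F (Do (Insert 1 3);; Do (IConst 1 0)) s 2
        (\<lambda>s'. s' = denote cost F (Do (Insert 1 3);; Do (IConst 1 0)) s)"
        using runs_loop_free[of "Do (Insert 1 3);; Do (IConst 1 0)" cost F s]
        by (simp add: numeral_2_eq_2)
    next
      fix s1 assume "s1 = denote cost F (Do (Insert 1 3);; Do (IConst 1 0)) s"
      then have s1: "\<forall>a. a \<noteq> 1 \<longrightarrow> ireg s1 a = ireg s a" "ireg s1 1 = 0" "rreg s1 = rreg s"
        "bits s1 1 = insert (ireg s 3) (bits s 1)" "bits s1 0 = bits s 0"
        by simp_all
      show "runs cost F (Loop (ILess 1 0) copy_body;; Do (Remove 1 3)) s1 (4 * n + 1 + 1) ?Q"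
      proof (rule runs_Seq[OF runs_copy])
        fix s2 :: state
        assume s2: "(\<forall>a. a \<noteq> 1 \<longrightarrow> ireg s2 a = ireg s1 a) \<and> rreg s2 = rreg s1 \<and>
          bits s2 1 = bits s1 1 \<and> bits s2 0 = bits s1 1"
        show "runs cost F (Do (Remove 1 3)) s2 1 ?Q"
          by (rule runs_mono[OF runs_loop_free]) (use s1 s2 h new in auto)
      qed (use s s1 h in auto)
    qed
  next
    assume "\<not> holds (ILess 3 0) s"
    then show "runs cost F (Do Nop) s (2 + (4 * n + 1 + 1)) ?Q"
      by (intro runs_mono[OF runs_loop_free]) (use s in auto)
  qed
  then show ?thesis by (rule runs_mono) auto
qed

section \<open>One greedy round\<close>

definition round_inv :: "state \<Rightarrow> bool" where
  "round_inv s \<longleftrightarrow>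
     ireg s 0 = n \<and> ireg s 4 = 1 \<and> bits s 1 \<subseteq> {..<n} \<and>
     rreg s 0 = K - weight (bits s 1) \<and> weight (bits s 1) \<le> K \<and> rreg s 1 = F (bits s 1) \<and>
     feasible [0..<n] cost K (bits s 0) \<and> rreg s 3 = F (bits s 0) \<and> F (bits s 1) \<le> rreg s 3 \<and>
     (\<forall>Opt e. feasible [0..<n] cost K Opt \<longrightarrow> e \<in> Opt \<longrightarrow> (\<forall>x\<in>Opt. cost x \<le> cost e) \<longrightarrow>
        half_progress (bits s 1) (rreg s 3) Opt e) \<and>
     (n \<le> ireg s 2 \<longrightarrow> candidates (bits s 1) = {})"

definition max_items :: nat where
  "max_items = nat \<lfloor>min (real n) K\<rfloor>"

text \<open>The successor accounts for the last round, whose scan finds no candidate.\<close>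

definition rounds_left :: "state \<Rightarrow> nat" where
  "rounds_left s = (if ireg s 2 < n then Suc (max_items - card (bits s 1)) else 0)"

lemma card_le_max_items:
  assumes "S \<subseteq> {..<n}" "weight S \<le> K"
  shows "card S \<le> max_items"
proof -
  have "card S \<le> n" using assms(1) by (metis card_lessThan card_mono finite_lessThan)
  moreover have "real (card S) \<le> K" using card_le_weight[of S] assms by (auto simp: atLeast0LessThan)
  ultimately show ?thesis unfolding max_items_def by (simp add: le_nat_floor)
qed

text \<open>The program knows neither an optimal set nor its costliest item, so the invariant
  carries \<open>half_progress\<close> for every feasible \<open>Opt\<close> and costliest
  \<open>e\<close> at once.\<close>

lemma runs_round:
  assumes inv: "round_inv s" and less: "ireg s 2 < n"
  shows "runs cost F greedy_round s (20 * n + 20)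
    (\<lambda>s'. round_inv s' \<and> rounds_left s' < rounds_left s)"
    (is "runs _ _ _ _ _ ?Q")
proof -
  define G where "G = bits s 1"
  define S where "S = bits s 0"
  note inv' = inv[unfolded round_inv_def, folded G_def S_def]
  have G: "G \<subseteq> {..<n}" and S: "S \<subseteq> {..<n}" using inv' by (auto simp: feasible_def atLeast0LessThan)
  have finG: "finite G" using G finite_subset by blast
  have "runs cost F greedy_round s (4 + ((16 * n + 1) + ((4 * n + 5 + 4) + 1))) ?Q"
    unfolding greedy_round_def
  proof (rule runs_Seq)
    show "runs cost F start_scan s 4 (\<lambda>s'. s' = denote cost F start_scan s)"
      by (rule runs_mono[OF runs_loop_free]) (simp_all add: start_scan_def)
  next
    fix s1 assume s1: "s1 = denote cost F start_scan s"
    have scan0: "scan_inv G S (F S) s1" "ireg s1 1 = 0"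
      using inv' s1
      by (simp_all add: scan_inv_def start_scan_def best_density_def best_value_def G_def S_def)
    show "runs cost F (Loop (ILess 1 0) scan_body;; Cond (ILess 2 0) (save;; extend) (Do Nop)) s1
      ((16 * n + 1) + ((4 * n + 5 + 4) + 1)) ?Q"
    proof (rule runs_Seq[OF runs_scan[OF scan0(1) G scan0(2)]], rule runs_Cond)
      fix s2 assume A: "scan_inv G S (F S) s2 \<and> ireg s2 1 = n"
      have all: "candidates G \<inter> {..<n} = candidates G" by (auto simp: candidates_def)
      have scanned: "ireg s2 1 = n" using A ..
      have s2: "ireg s2 0 = n" "ireg s2 4 = 1" "bits s2 1 = G" "bits s2 0 = S"
        "rreg s2 0 = K - weight G" "rreg s2 1 = F G"
        "best_density G (candidates G) (ireg s2 2) (rreg s2 2)"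
        "best_value G (candidates G) (F S) (ireg s2 3) (rreg s2 3)"
        using conjunct1[OF A, unfolded scan_inv_def scanned all] by blast+
      {
        assume "\<not> holds (ILess 2 0) s2"
        then have "ireg s2 2 \<ge> n" using s2 by simp
        then have none: "candidates G = {}"
          using s2(7) by (auto simp: best_density_def candidates_def)
        then have "rreg s2 3 = F S" using s2(8) by (auto simp: best_value_def)
        then have "?Q s2"
          using s2 inv' none \<open>ireg s2 2 \<ge> n\<close> less by (auto simp: round_inv_def rounds_left_def)
        then show "runs cost F (Do Nop) s2 (4 * n + 5 + 4) ?Q"
          by (intro runs_mono[OF runs_loop_free]) auto
      }
      assume "holds (ILess 2 0) s2"
      then have "ireg s2 2 < n" using s2 by simp
      define g where "g = ireg s2 2"
      define h where "h = ireg s2 3"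
      define v where "v = rreg s2 3"
      have g: "g \<in> candidates G" "\<And>x. x \<in> candidates G \<Longrightarrow> density G x \<le> density G g"
        using s2(7) \<open>ireg s2 2 < n\<close> by (auto simp: best_density_def g_def)
      then have gn: "g < n" "g \<notin> G" "weight G + cost g \<le> K"
        by (auto simp: candidates_def)
      have v: "F S \<le> v" "\<And>x. x \<in> candidates G \<Longrightarrow> F (insert x G) \<le> v"
        "h = n \<and> v = F S \<or> h \<in> candidates G \<and> v = F (insert h G)"
        using s2(8) by (auto simp: best_value_def h_def v_def)
      \<comment> \<open>This includes the default \<open>h = n\<close>, which lies outside
        \<open>G\<close> because \<open>G\<close> is below \<open>n\<close>.\<close>
      have hG: "h \<notin> G" using v(3) G by (auto simp: candidates_def)
      show "runs cost F (save;; extend) s2 (4 * n + 5 + 4) ?Q"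
      proof (rule runs_Seq[OF runs_save])
        fix s3 :: state
        define S' where "S' = (if h < n then insert h G else S)"
        assume "(\<forall>a. a \<noteq> 1 \<longrightarrow> ireg s3 a = ireg s2 a) \<and> rreg s3 = rreg s2 \<and> bits s3 1 = bits s2 1 \<and>
          bits s3 0 = (if ireg s2 3 < n then insert (ireg s2 3) (bits s2 1) else bits s2 0)"
        then have s3: "ireg s3 0 = n" "ireg s3 4 = 1" "ireg s3 2 = g" "rreg s3 = rreg s2"
          "bits s3 1 = G" "bits s3 0 = S'"
          using s2 by (auto simp: S'_def h_def g_def)
        have S': "feasible [0..<n] cost K S'" "F S' = v"
          using v(3) inv' finG hG G
          by (auto simp: S'_def feasible_def candidates_def)
        have half: "half_progress (insert g G) v Opt e"
          if "feasible [0..<n] cost K Opt" "e \<in> Opt" "\<forall>x\<in>Opt. cost x \<le> cost e" for Opt e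
        proof (rule half_progress_insert[OF that(1,2)])
          show "half_progress G (F S) Opt e" using inv' that by auto
        qed (use that v g G inv' in \<open>auto simp: atLeast0LessThan\<close>)
        define s4 where "s4 = denote cost F extend s3"
        have s4: "ireg s4 = ireg s3" "bits s4 1 = insert g G" "bits s4 0 = S'"
          "rreg s4 0 = K - weight (insert g G)" "rreg s4 1 = F (insert g G)" "rreg s4 3 = v"
          using s3 s2 finG gn by (auto simp: s4_def extend_def v_def)
        have w: "weight (insert g G) \<le> K" using gn finG by simp
        have sub: "insert g G \<subseteq> {..<n}" using gn G by auto
        have "round_inv s4"
          using s4 s3 S' half w sub gn v(2)[OF g(1)] by (auto simp: round_inv_def)
        \<comment> \<open>The bound by \<open>max_items\<close> ensures that the truncated
          subtraction in \<open>rounds_left\<close> really decreases.\<close>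
        moreover have "card (insert g G) = Suc (card G)" "card (insert g G) \<le> max_items"
          using gn finG card_le_max_items[OF sub w] by auto
        then have "rounds_left s4 < rounds_left s"
          using s4 s3 less gn by (auto simp: rounds_left_def G_def)
        ultimately show "runs cost F extend s3 4 ?Q"
          by (intro runs_mono[OF runs_loop_free]) (auto simp: extend_def s4_def)
      qed (use s2 G S hG h_def in auto)
    qed
  qed
  then show ?thesis by (rule runs_mono) auto
qed

section \<open>The complete run\<close>

lemma feasible_empty: "feasible [0..<n] cost K {}"
  using capacity_pos by (simp add: feasible_def)

lemma runs_greedy_max:
  "runs cost F greedy_max (initial_state n K) (3 + ((max_items + 1) * (20 * n + 21) + 1))
    (\<lambda>s. feasible [0..<n] cost K (bits s 0) \<and>
      (\<forall>Opt. feasible [0..<n] cost K Opt \<longrightarrow> F Opt / 2 \<le> F (bits s 0)))"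
    (is "runs _ _ _ _ _ ?Q")
  unfolding greedy_max_def
proof (rule runs_Seq)
  let ?init = "Do (Query 3 1);; Do (RCopy 1 3);; Do (IConst 4 1)"
  show "runs cost F ?init (initial_state n K) 3 (\<lambda>s. s = denote cost F ?init (initial_state n K))"
    by (rule runs_mono[OF runs_loop_free]) auto
next
  fix s assume s: "s = denote cost F (Do (Query 3 1);; Do (RCopy 1 3);; Do (IConst 4 1)) (initial_state n K)"
  \<comment> \<open>For \<open>n = 0\<close> the loop is never entered, so the exit clause of
    \<open>round_inv\<close> must hold from the start.\<close>
  have none: "candidates {} = {}" if "n = 0"
    unfolding candidates_def by (simp add: that)
  have inv: "round_inv s"
    using s capacity_pos feasible_empty none
    by (auto simp: round_inv_def initial_state_def half_progress_empty)
  have "runs cost F (Loop (ILess 2 0) greedy_round) s (rounds_left s * (20 * n + 20 + 1) + 1)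
    (\<lambda>s. round_inv s \<and> \<not> holds (ILess 2 0) s)"
    by (rule runs_Loop[where I = round_inv and m = rounds_left, OF inv])
      (simp add: runs_round round_inv_def[THEN iffD1, THEN conjunct1])
  then show "runs cost F (Loop (ILess 2 0) greedy_round) s ((max_items + 1) * (20 * n + 21) + 1) ?Q"
  proof (rule runs_mono)
    show "rounds_left s * (20 * n + 20 + 1) + 1 \<le> (max_items + 1) * (20 * n + 21) + 1"
      by (intro add_right_mono mult_mono) (auto simp: rounds_left_def)
  next
    fix s assume A: "round_inv s \<and> \<not> holds (ILess 2 0) s"
    then have G: "bits s 1 \<subseteq> set [0..<n]" "candidates (bits s 1) = {}" "F (bits s 1) \<le> rreg s 3"
      "rreg s 3 = F (bits s 0)" "feasible [0..<n] cost K (bits s 0)"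
      by (auto simp: round_inv_def)
    have "F Opt / 2 \<le> F (bits s 0)" if O: "feasible [0..<n] cost K Opt" for Opt
    \<comment> \<open>An empty \<open>Opt\<close> has no costliest item; there monotonicity and
      nonnegativity suffice.\<close>
    proof (cases "Opt = {}")
      case True
      have "F {} \<le> F (bits s 0)" "0 \<le> F {}"
        using G(5) nonneg by (auto intro!: f_mono simp: feasible_def)
      then show ?thesis using True by simp
    next
      case False
      have "finite Opt" using O by (auto simp: feasible_def intro: finite_subset)
      then have "Max (cost ` Opt) \<in> cost ` Opt" "\<forall>x\<in>Opt. cost x \<le> Max (cost ` Opt)"
        using False by auto
      then obtain e where e: "e \<in> Opt" "\<forall>x\<in>Opt. cost x \<le> cost e" by auto
      then have "half_progress (bits s 1) (rreg s 3) Opt e"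
        using A O by (auto simp: round_inv_def)
      then show ?thesis
        using half_progress_final[OF O _ G(1) G(3) G(2)] e G(4) by auto
    qed
    with G(5) show "?Q s" by blast
  qed
qed

end

section \<open>Transfer to items\<close>

context submodular_knapsack
begin

abbreviation index_cost :: "nat \<Rightarrow> real" where
  "index_cost \<equiv> \<lambda>i. if i < length es then c (es ! i) else 0"

abbreviation index_value :: "nat set \<Rightarrow> real" where
  "index_value \<equiv> \<lambda>I. f (select es I)"

lemma select_subset: "select es I \<subseteq> set es"
  by (auto simp: select_def)

lemma select_mono: "I \<subseteq> J \<Longrightarrow> select es I \<subseteq> select es J"
  by (auto simp: select_def)

lemma select_image: "I \<subseteq> {..<length es} \<Longrightarrow> select es I = (!) es ` I"
  by (auto simp: select_def)

text \<open>\<open>select\<close> is monotone and turns the insertion of a valid index into that of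
  its item, so the properties of \<open>f\<close> carry over.\<close>

lemma indexed: "indexed_knapsack (length es) index_cost K index_value"
proof (unfold indexed_knapsack_def, unfold_locales)
  show "submodular_on {..<length es} index_value"
    unfolding submodular_on_def
  proof (intro allI ballI impI)
    fix I J :: "nat set" and e assume "e \<in> {..<length es}" "I \<subseteq> J"
    then have "select es (A \<union> {e}) = insert (es ! e) (select es A)" for A
      by (auto simp: select_def)
    moreover have "es ! e \<in> U" using \<open>e \<in> {..<length es}\<close> items_subset by auto
    ultimately show "index_value (J \<union> {e}) - index_value J \<le> index_value (I \<union> {e}) - index_value I"
      using f_submodular[OF select_mono[OF \<open>I \<subseteq> J\<close>]] select_subset[of J] items_subset by auto
  qed
  show "mono_on (Pow {..<length es}) index_value"
    by (intro mono_onI f_mono select_mono order_trans[OF select_subset items_subset])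
  show "\<forall>S\<subseteq>{..<length es}. 0 \<le> index_value S"
    using nonneg select_subset items_subset by (meson order_trans)
qed (use capacity_pos cost_bounds in auto)

text \<open>Distinctness of \<open>es\<close> makes indexing injective, so no cost is lost or
  counted twice.\<close>

lemma feasible_select:
  assumes "I \<subseteq> {..<length es}"
  shows "feasible es c K (select es I) \<longleftrightarrow> feasible [0..<length es] index_cost K I"
proof -
  have "inj_on ((!) es) I"
    using assms distinct_items by (auto intro!: inj_on_nth)
  then have "weight (select es I) = sum index_cost I"
    using assms by (auto simp: select_image sum.reindex intro!: sum.cong)
  then show ?thesis using assms select_subset by (auto simp: feasible_def)
qed

lemma greedy_max_correct:
  "\<exists>S q t. computes greedy_max es c K f S q t \<and> approximates (1/2) es c K f S \<and> q \<le> t \<and>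
     t \<le> 3 + ((nat \<lfloor>K_tilde (length es) K\<rfloor> + 1) * (20 * length es + 21) + 1)"
proof -
  interpret I: indexed_knapsack "length es" index_cost K index_value by (rule indexed)
  obtain q t s where s: "exec index_cost index_value greedy_max (initial_state (length es) K) q t s"
    "t \<le> 3 + ((I.max_items + 1) * (20 * length es + 21) + 1)"
    and feas: "feasible [0..<length es] index_cost K (bits s 0)"
    and best: "\<And>Opt. feasible [0..<length es] index_cost K Opt \<Longrightarrow>
      index_value Opt / 2 \<le> index_value (bits s 0)"
    using I.runs_greedy_max unfolding runs_def by blast
  have "approximates (1/2) es c K f (select es (bits s 0))"
    unfolding approximates_def
  proof (intro conjI allI impI)
    have "bits s 0 \<subseteq> {..<length es}" using feas by (auto simp: feasible_def)
    then show "feasible es c K (select es (bits s 0))" using feas feasible_select by blast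
    fix Opt assume "is_arg_max f (feasible es c K) Opt"
    then have O: "feasible es c K Opt" by (simp add: is_arg_max_def)
    \<comment> \<open>The preimage of \<open>Opt\<close> is a feasible competitor in the indexed
      instance.\<close>
    define J where "J = {i. i < length es \<and> es ! i \<in> Opt}"
    have "Opt \<subseteq> set es" using O by (simp add: feasible_def)
    then have "select es J = Opt" by (force simp: select_def J_def in_set_conv_nth)
    moreover have "J \<subseteq> {..<length es}" by (auto simp: J_def)
    ultimately show "1 / 2 * f Opt \<le> f (select es (bits s 0))"
      using best[of J] feasible_select[of J] O by auto
  qed
  with s exec_queries_le_time[OF s(1)] show ?thesis
    unfolding computes_def I.max_items_def K_tilde_def by blast
qed

lemma time_bound:
  assumes "length es \<ge> 1"
    and t: "t \<le> 3 + ((nat \<lfloor>K_tilde (length es) K\<rfloor> + 1) * (20 * length es + 21) + 1)"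
  shows "real t \<le> 86 * (K_tilde (length es) K * real (length es))"
proof -
  let ?k = "K_tilde (length es) K" and ?n = "real (length es)"
  have "es ! 0 \<in> set es" using assms(1) by (simp add: Suc_le_eq)
  then have "1 \<le> K" using cost_bounds by force
  then have k: "1 \<le> ?k" and n: "1 \<le> ?n" using assms(1) by (auto simp: K_tilde_def)
  have kn: "1 \<le> ?k * ?n" using mult_mono[OF k n] k by simp
  have fl: "real (nat \<lfloor>?k\<rfloor>) + 1 \<le> 2 * ?k" using k of_nat_floor[of ?k] by linarith
  have "real t \<le> real (3 + ((nat \<lfloor>?k\<rfloor> + 1) * (20 * length es + 21) + 1))"
    using t of_nat_mono by blast
  also have "\<dots> = (real (nat \<lfloor>?k\<rfloor>) + 1) * (20 * ?n + 21) + 4" by (simp add: algebra_simps)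
  \<comment> \<open>One item forces \<open>K \<ge> 1\<close>, so both factors are at least 1 and
    absorb the constants: 2 * 41 + 4 = 86.\<close>
  also have "\<dots> \<le> (2 * ?k) * (41 * ?n) + 4 * (?k * ?n)"
    using k n kn by (intro add_mono mult_mono fl) auto
  also have "\<dots> = 86 * (?k * ?n)" by simp
  finally show ?thesis .
qed

end

theorem theorem1:
  "\<exists>(P :: prog) (C :: real). \<forall>(U :: 'a set) (es :: 'a list) (c :: 'a \<Rightarrow> real) (K :: real)
      (f :: 'a set \<Rightarrow> real).
     submodular_knapsack U es c K f \<longrightarrow>
     (\<exists>S q t. computes P es c K f S q t \<and>
        approximates (1/2) es c K f S \<and>
        (length es \<ge> 1 \<longrightarrow>
           real q \<le> C * (K_tilde (length es) K * real (length es)) \<and>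
           real t \<le> C * (K_tilde (length es) K * real (length es))))"
proof (intro exI[of _ greedy_max] exI[of _ 86] allI impI)
  fix U :: "'a set" and es :: "'a list" and c K f
  assume "submodular_knapsack U es c K f"
  then interpret submodular_knapsack U es c K f .
  obtain S q t where "computes greedy_max es c K f S q t" "approximates (1/2) es c K f S" "q \<le> t"
    and t: "t \<le> 3 + ((nat \<lfloor>K_tilde (length es) K\<rfloor> + 1) * (20 * length es + 21) + 1)"
    using greedy_max_correct by blast
  moreover have "real q \<le> real t" using \<open>q \<le> t\<close> by simp
  ultimately show "\<exists>S q t. computes greedy_max es c K f S q t \<and>
        approximates (1/2) es c K f S \<and>
        (length es \<ge> 1 \<longrightarrow>
           real q \<le> 86 * (K_tilde (length es) K * real (length es)) \<and>
           real t \<le> 86 * (K_tilde (length es) K * real (length es)))"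
    using time_bound[OF _ t] by (meson order_trans)
qed

end
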